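(* Let $a$ be a constant nonzero semisimple $2\times2$ matrix and let $U=(u_{ij})_{i,j\in\mathbb{Z}}$ be a matrix of $2\times2$ blocks $u_{ij}$ depending on $\boldsymbol{t}=(t_1,t_2,\ldots)$ that satisfies $$\frac{\partial U}{\partial t_k}=(a\otimes\Lambda^k)U-U(a\otimes\Lambda^{-k})-U(a\otimes\mathcal{O}_k)U,\qquad k=1,2,\ldots,$$ together with the constraint $$(E_2\otimes\Lambda)U-U(E_2\otimes\Lambda^{-1})-U(E_2\otimes\mathcal{O}_1)U=0.$$ Then $g=E-U(E_2\otimes\Omega)$ and $\bar g=E-U(E_2\otimes\bar\Omega)$ satisfy, for $k=1,2,\ldots$, $$\frac{\partial g}{\partial t_k}=\bigl(a\otimes\Lambda^k-U(a\otimes\mathcal{O}_k)\bigr)g-g(a\otimes\Lambda^k),$$ $$\frac{\partial\bar g}{\partial t_k}=\bigl(a\otimes\Lambda^k-U(a\otimes\mathcal{O}_k)\bigr)\bar g-\bar g(a\otimes\Lambda^k).$$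
   Context: $E_{ij}$ denotes the scalar $\mathbb{Z}\times\mathbb{Z}$ matrix unit, $E_2$ the $2\times2$ unit matrix, and $E$ the unit matrix with $2\times2$ blocks $\delta_{ij}E_2$. $\Lambda^k=\sum_{i\in\mathbb{Z}}E_{i,i+k}$ ($k\in\mathbb{Z}$), $\mathcal{O}_k=\sum_{i=0}^{k-1}E_{i,k-i-1}$ ($k\ge1$), $\Omega=\sum_{i=0}^\infty E_{i,-i-1}$, $\bar\Omega=-\sum_{i=0}^\infty E_{-i-1,i}$. For a $2\times2$ matrix $A$ and a scalar $\mathbb{Z}\times\mathbb{Z}$ matrix $B=(b_{ij})$, $A\otimes B$ is the block matrix with $(i,j)$ block $b_{ij}A$, so that $(A\otimes B)U=\bigl(\sum_kb_{ik}Au_{kj}\bigr)_{ij}$ and $U(A\otimes B)=\bigl(\sum_ku_{ik}Ab_{kj}\bigr)_{ij}$. *)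

theory Defs
  imports "HOL-Analysis.Analysis" "HOL-Library.Groups_Big_Fun"
begin

type_synonym scalar_mat = "int \<Rightarrow> int \<Rightarrow> complex"
type_synonym block_mat = "int \<Rightarrow> int \<Rightarrow> complex^2^2"

definition unit_mat :: "int \<Rightarrow> int \<Rightarrow> scalar_mat" where
  "unit_mat p q = (\<lambda>i j. if i = p \<and> j = q then 1 else 0)"

(* For infinite families the sums are taken entrywise; each entry then has at most one
   nonzero summand, so Sum_any never falls back to its default value. *)

definition Lam :: "int \<Rightarrow> scalar_mat" where
  "Lam k = (\<lambda>i j. Sum_any (\<lambda>l::int. unit_mat l (l + k) i j))"

definition Ocal :: "nat \<Rightarrow> scalar_mat" where
  "Ocal k = (\<lambda>i j. \<Sum>l<k. unit_mat (int l) (int k - int l - 1) i j)"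

definition Omega :: scalar_mat where
  "Omega = (\<lambda>i j. Sum_any (\<lambda>l::nat. unit_mat (int l) (- int l - 1) i j))"

definition Omega_bar :: scalar_mat where
  "Omega_bar = (\<lambda>i j. - Sum_any (\<lambda>l::nat. unit_mat (- int l - 1) (int l) i j))"

lemma Lam_entry: "Lam k i j = (if j = i + k then 1 else 0)"
  unfolding Lam_def
  by (subst Sum_any.expand_superset[of "{i}"]) (auto simp: unit_mat_def)

lemma Ocal_entry: "Ocal k i j = (if 0 \<le> i \<and> 0 \<le> j \<and> i + j = int k - 1 then 1 else 0)"
proof -
  have "Ocal k i j = (\<Sum>l<k. if l = nat i then
      (if 0 \<le> i \<and> j = int k - i - 1 then 1 else 0) else 0)"
    unfolding Ocal_def by (rule sum.cong) (auto simp: unit_mat_def)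
  also have "\<dots> = (if 0 \<le> i \<and> 0 \<le> j \<and> i + j = int k - 1 then 1 else 0)"
    by auto
  finally show ?thesis .
qed

lemma Omega_entry: "Omega i j = (if 0 \<le> i \<and> j = - i - 1 then 1 else 0)"
  unfolding Omega_def
  by (subst Sum_any.expand_superset[of "{nat i}"]) (auto simp: unit_mat_def)

lemma Omega_bar_entry: "Omega_bar i j = (if 0 \<le> j \<and> i = - j - 1 then - 1 else 0)"
  unfolding Omega_bar_def
  by (subst Sum_any.expand_superset[of "{nat j}"]) (auto simp: unit_mat_def)

definition E_block :: block_mat where
  "E_block = (\<lambda>i j. if i = j then mat 1 else 0)"

definition tensor :: "complex^2^2 \<Rightarrow> scalar_mat \<Rightarrow> block_mat" (infixl "\<otimes>" 75) where
  "A \<otimes> B = (\<lambda>i j. \<chi> p q. B i j * A $ p $ q)"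

(* A product of doubly infinite matrices is meaningful when every entry is a finite sum
   (Sum_any is 0 otherwise). *)

definition block_mult :: "block_mat \<Rightarrow> block_mat \<Rightarrow> block_mat" (infixl "\<odot>" 70) where
  "X \<odot> Y = (\<lambda>i j. Sum_any (\<lambda>k. X i k ** Y k j))"

lemma block_mult_finite:
  assumes "finite S" and "\<And>k. k \<notin> S \<Longrightarrow> X i k = 0 \<or> Y k j = 0"
  shows "(X \<odot> Y) i j = (\<Sum>k\<in>S. X i k ** Y k j)"
  unfolding block_mult_def
  by (rule Sum_any.expand_superset) (use assms in \<open>fastforce simp: matrix_matrix_mult_def vec_eq_iff\<close>)+

lemma tensor_one: "B i j = 1 \<Longrightarrow> (A \<otimes> B) i j = A"
  and tensor_zero: "B i j = 0 \<Longrightarrow> (A \<otimes> B) i j = 0"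
  by (simp_all add: tensor_def vec_eq_iff)

lemma Lam_block_mult: "((A \<otimes> Lam k) \<odot> X) i j = A ** X (i + k) j"
  by (subst block_mult_finite[of "{i + k}"]) (auto simp: tensor_one tensor_zero Lam_entry)

lemma block_mult_Lam: "(X \<odot> (A \<otimes> Lam k)) i j = X i (j - k) ** A"
  by (subst block_mult_finite[of "{j - k}"]) (auto simp: tensor_one tensor_zero Lam_entry)

lemma block_mult_Ocal:
  "(X \<odot> (A \<otimes> Ocal k)) i j = (if 0 \<le> j \<and> j < int k then X i (int k - 1 - j) ** A else 0)"
  by (subst block_mult_finite[of "{int k - 1 - j}"]) (auto simp: tensor_one tensor_zero Ocal_entry)

lemma block_mult_Omega:
  "(X \<odot> (mat 1 \<otimes> Omega)) i j = (if j < 0 then X i (- j - 1) else 0)"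
  by (subst block_mult_finite[of "{- j - 1}"]) (auto simp: tensor_one tensor_zero Omega_entry)

lemma block_mult_Omega_bar:
  "(X \<odot> (mat 1 \<otimes> Omega_bar)) i j = (if 0 \<le> j then - X i (- j - 1) else 0)"
proof -
  have "(mat 1 \<otimes> Omega_bar) (- j - 1) j = (if 0 \<le> j then - mat 1 else 0)"
    by (simp add: tensor_def vec_eq_iff Omega_bar_entry)
  moreover have "X i (- j - 1) ** (- mat 1) = - X i (- j - 1)"
    by (simp add: matrix_matrix_mult_def mat_def vec_eq_iff sum_negf if_distrib sum.delta cong: if_cong)
  ultimately show ?thesis
    by (subst block_mult_finite[of "{- j - 1}"]) (auto simp: tensor_zero Omega_bar_entry)
qed

definition invariant_subspace :: "complex^2^2 \<Rightarrow> (complex^2) set \<Rightarrow> bool" where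
  "invariant_subspace A V \<longleftrightarrow> vec.subspace V \<and> (\<forall>v\<in>V. A *v v \<in> V)"

definition semisimple :: "complex^2^2 \<Rightarrow> bool" where
  "semisimple A \<longleftrightarrow> (\<forall>V. invariant_subspace A V \<longrightarrow>
     (\<exists>W. invariant_subspace A W \<and> V \<inter> W = {0} \<and> (\<forall>x. \<exists>v\<in>V. \<exists>w\<in>W. x = v + w)))"

(* Times are sequences t with t k standing for t_k, k \<ge> 1; the coordinate t 0 plays no role.
   T is the set of times on which the functions live.  It may be a set of complex times
   (partial derivatives are then complex derivatives) or of real times, i.e. sequences with
   values in \<real> \<subseteq> complex (partial derivatives are then derivatives with respect to
   a real variable).  The condition makes partial derivatives unique. *)

definition time_domain :: "(nat \<Rightarrow> complex) set \<Rightarrow> bool" where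
  "time_domain T \<longleftrightarrow> (\<forall>t\<in>T. \<forall>k\<ge>1. t k islimpt {x. t(k := x) \<in> T})"

definition has_partial_derivative ::
  "(nat \<Rightarrow> complex) set \<Rightarrow> nat \<Rightarrow> ((nat \<Rightarrow> complex) \<Rightarrow> block_mat) \<Rightarrow> block_mat \<Rightarrow> (nat \<Rightarrow> complex) \<Rightarrow> bool"
where
  "has_partial_derivative T k F D t \<longleftrightarrow>
     (\<forall>i j p q. ((\<lambda>x. F (t(k := x)) i j $ p $ q) has_field_derivative D i j $ p $ q)
        (at (t k) within {x. t(k := x) \<in> T}))"

end

theory Submission
  imports Defs
begin

text \<open>
  Entrywise, \<open>g i j\<close> is \<open>\<delta> i j\<close>, minus \<open>U i (- j - 1)\<close> if \<open>j < 0\<close>, and \<open>g_bar i j\<close> is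
  \<open>\<delta> i j\<close>, plus \<open>U i (- j - 1)\<close> if \<open>j \<ge> 0\<close>. In the columns containing an entry of \<open>U\<close>, the
  right-hand side is the equation for \<open>U\<close> read off in column \<open>- j - 1\<close>; in the other columns it
  vanishes. The only interaction between the two kinds of columns is at \<open>0 \<le> j < k\<close>, where the
  term \<open>U i (k - 1 - j) ** a\<close> coming from \<open>U (a \<otimes> Ocal k) E\<close> either cancels against \<open>g (a \<otimes> Lam k)\<close>
  or makes up for its absence from \<open>g_bar (a \<otimes> Lam k)\<close>; this is the
  identity \<open>\<Omega> \<Lambda>\<^sup>k - \<Lambda>\<^sup>-\<^sup>k \<Omega> = \<O>\<^sub>k\<close>, which also holds for the second matrix.
\<close>

lemma block_mult_Ocal_block_mult:
  "(X \<odot> (A \<otimes> Ocal k) \<odot> Y) i j = (\<Sum>m\<in>{0..<int k}. X i (int k - 1 - m) ** A ** Y m j)"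
  by (subst block_mult_finite[of "{0..<int k}"]) (auto simp: block_mult_Ocal)

lemma matrix_mult_diff_left: "(A - B) ** C = A ** C - B ** (C :: complex^2^2)"
  and matrix_mult_diff_right: "C ** (A - B) = C ** A - C ** (B :: complex^2^2)"
  and matrix_mult_add_left: "(A + B) ** C = A ** C + B ** (C :: complex^2^2)"
  by (simp_all add: matrix_matrix_mult_def vec_eq_iff sum_2 algebra_simps)

text \<open>Row \<open>i\<close> of the operator lives on column \<open>i + int k\<close> and the
  columns in \<open>{0..<int k}\<close>; this finite support lets \<open>Sum_any\<close> be split
  across the difference.\<close>

lemma dressing_block_mult:
  "((A \<otimes> Lam (int k) - X \<odot> (A \<otimes> Ocal k)) \<odot> Y) i j =
     A ** Y (i + int k) j - (\<Sum>m\<in>{0..<int k}. X i (int k - 1 - m) ** A ** Y m j)"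
proof -
  let ?S = "insert (i + int k) {0..<int k}"
  have "((A \<otimes> Lam (int k) - X \<odot> (A \<otimes> Ocal k)) \<odot> Y) i j =
      (\<Sum>m\<in>?S. (A \<otimes> Lam (int k) - X \<odot> (A \<otimes> Ocal k)) i m ** Y m j)"
    by (rule block_mult_finite) (auto simp: tensor_zero Lam_entry block_mult_Ocal)
  also have "\<dots> = (\<Sum>m\<in>?S. (A \<otimes> Lam (int k)) i m ** Y m j) -
      (\<Sum>m\<in>?S. (X \<odot> (A \<otimes> Ocal k)) i m ** Y m j)"
    by (simp only: minus_apply matrix_mult_diff_left sum_subtractf)
  also have "(\<Sum>m\<in>?S. (A \<otimes> Lam (int k)) i m ** Y m j) = ((A \<otimes> Lam (int k)) \<odot> Y) i j"
    by (rule block_mult_finite[symmetric]) (auto simp: tensor_zero Lam_entry)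
  also have "(\<Sum>m\<in>?S. (X \<odot> (A \<otimes> Ocal k)) i m ** Y m j) = (X \<odot> (A \<otimes> Ocal k) \<odot> Y) i j"
    by (rule block_mult_finite[symmetric]) (auto simp: block_mult_Ocal)
  finally show ?thesis
    by (simp only: Lam_block_mult block_mult_Ocal_block_mult)
qed

lemma Ocal_sum_E_block:
  "(\<Sum>m\<in>{0..<int k}. X i (int k - 1 - m) ** A ** E_block m j) =
     (if 0 \<le> j \<and> j < int k then X i (int k - 1 - j) ** A else (0 :: complex^2^2))"
proof -
  have "(\<Sum>m\<in>{0..<int k}. X i (int k - 1 - m) ** A ** E_block m j) =
      (\<Sum>m\<in>{0..<int k}. if m = j then X i (int k - 1 - j) ** A else 0)"
    by (rule sum.cong) (auto simp: E_block_def)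
  then show ?thesis by simp
qed

lemma E_block_commute: "A ** E_block (i + k) j = E_block i (j - k) ** A"
  by (auto simp: E_block_def)

text \<open>The derivative prescribed for \<open>U\<close>, kept folded while columns are
  compared.\<close>

definition evolution :: "complex^2^2 \<Rightarrow> nat \<Rightarrow> block_mat \<Rightarrow> block_mat" where
  "evolution A k X =
     (A \<otimes> Lam (int k)) \<odot> X - X \<odot> (A \<otimes> Lam (- int k)) - X \<odot> (A \<otimes> Ocal k) \<odot> X"

text \<open>The \<open>E_block\<close> part commutes with the shift; the sign is that of
  \<open>X\<close> in \<open>Y\<close>.\<close>

lemma dressing_Omega:
  fixes X :: block_mat
  defines "Y \<equiv> E_block - X \<odot> (mat 1 \<otimes> Omega)"
  shows "((A \<otimes> Lam (int k) - X \<odot> (A \<otimes> Ocal k)) \<odot> Y - Y \<odot> (A \<otimes> Lam (int k))) i j =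
    (if j < 0 then - evolution A k X i (- j - 1) else 0)"
  by (simp_all add: Y_def evolution_def dressing_block_mult block_mult_Lam Lam_block_mult
      block_mult_Ocal_block_mult block_mult_Omega matrix_mult_diff_left matrix_mult_diff_right
      sum_subtractf Ocal_sum_E_block E_block_commute) (auto simp: algebra_simps)

text \<open>The entries \<open>-1\<close> of \<open>Omega_bar\<close> make the sign positive. For
  \<open>0 \<le> j < k\<close> the right shift reaches column \<open>j - k < 0\<close>, where
  \<open>Y\<close> has no \<open>X\<close> term.\<close>

lemma dressing_Omega_bar:
  fixes X :: block_mat
  defines "Y \<equiv> E_block - X \<odot> (mat 1 \<otimes> Omega_bar)"
  shows "((A \<otimes> Lam (int k) - X \<odot> (A \<otimes> Ocal k)) \<odot> Y - Y \<odot> (A \<otimes> Lam (int k))) i j =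
    (if 0 \<le> j then evolution A k X i (- j - 1) else 0)"
  by (simp_all add: Y_def evolution_def dressing_block_mult block_mult_Lam Lam_block_mult
      block_mult_Ocal_block_mult block_mult_Omega_bar matrix_add_ldistrib
      matrix_mult_add_left sum.distrib Ocal_sum_E_block E_block_commute) (auto simp: algebra_simps)

theorem proposition12:
  fixes a :: "complex^2^2"
    and T :: "(nat \<Rightarrow> complex) set"
    and U g g_bar :: "(nat \<Rightarrow> complex) \<Rightarrow> block_mat"
  assumes "a \<noteq> 0" and "semisimple a"
    and "time_domain T"
    and "\<And>t k. t \<in> T \<Longrightarrow> k \<ge> 1 \<Longrightarrow>
      has_partial_derivative T k U
        ((a \<otimes> Lam (int k)) \<odot> U t - U t \<odot> (a \<otimes> Lam (- int k)) - U t \<odot> (a \<otimes> Ocal k) \<odot> U t) t"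
    and "\<And>t. t \<in> T \<Longrightarrow>
      (mat 1 \<otimes> Lam 1) \<odot> U t - U t \<odot> (mat 1 \<otimes> Lam (- 1)) - U t \<odot> (mat 1 \<otimes> Ocal 1) \<odot> U t
        = (\<lambda>i j. 0)"
    and "g = (\<lambda>t. E_block - U t \<odot> (mat 1 \<otimes> Omega))"
    and "g_bar = (\<lambda>t. E_block - U t \<odot> (mat 1 \<otimes> Omega_bar))"
  shows "\<forall>t\<in>T. \<forall>k\<ge>1.
      has_partial_derivative T k g
        ((a \<otimes> Lam (int k) - U t \<odot> (a \<otimes> Ocal k)) \<odot> g t - g t \<odot> (a \<otimes> Lam (int k))) t \<and>
      has_partial_derivative T k g_bar
        ((a \<otimes> Lam (int k) - U t \<odot> (a \<otimes> Ocal k)) \<odot> g_bar t - g_bar t \<odot> (a \<otimes> Lam (int k))) t"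
proof (intro ballI allI impI conjI)
  fix t k assume "t \<in> T" and "k \<ge> (1::nat)"
  then have deriv_U: "((\<lambda>x. U (t(k := x)) i j $ p $ q) has_field_derivative
      evolution a k (U t) i j $ p $ q) (at (t k) within {x. t(k := x) \<in> T})" for i j p q
    using assms(4)[of t k] unfolding has_partial_derivative_def evolution_def by blast
  show "has_partial_derivative T k g
      ((a \<otimes> Lam (int k) - U t \<odot> (a \<otimes> Ocal k)) \<odot> g t - g t \<odot> (a \<otimes> Lam (int k))) t"
    \<comment> \<open>Each entry of \<open>g\<close> is constant in time or a constant minus an
      entry of \<open>U\<close>.\<close>
    unfolding has_partial_derivative_def assms(6) dressing_Omega
    by (auto simp: block_mult_Omega intro!: derivative_eq_intros deriv_U)
  show "has_partial_derivative T k g_bar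
      ((a \<otimes> Lam (int k) - U t \<odot> (a \<otimes> Ocal k)) \<odot> g_bar t - g_bar t \<odot> (a \<otimes> Lam (int k))) t"
    unfolding has_partial_derivative_def assms(7) dressing_Omega_bar
    by (auto simp: block_mult_Omega_bar intro!: derivative_eq_intros deriv_U)
qed

end
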